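(* Let $G$ be a group, let $\mu_1,\mu_2,\chi$ be three pairwise different characters of $G$, and put $g:=\frac{\mu_1+\mu_2}{2}$. The solutions $f,h_1,h_2,h:G\to\mathbb{C}$ of the functional equation $$f(xy)=f(x)h_1(y)+g(x)h_2(y)+\chi(x)h(y)\quad\text{for all }x,y\in G$$ are exactly the quadruples $(f,h_1,h_2,h)$ of one of the following forms: (1) $f=c\mu+\varphi_{\mu,\chi}$, $h_1=\mu$, $h_2=0$ and $h=\varphi_{\mu,\chi}$, where $\mu$ is a character of $G$, $c\in\mathbb{C}$ is a constant, and $\varphi_{\mu,\chi}:G\to\mathbb{C}$ is a solution of $\varphi_{\mu,\chi}(xy)=\varphi_{\mu,\chi}(x)\mu(y)+\chi(x)\varphi_{\mu,\chi}(y)$ for all $x,y\in G$; (2) $f=c\chi$, $h_1$ is arbitrary, $h_2=0$ and $h=c(\chi-h_1)$, where $c\in\mathbb{C}$ is a constant; (3) $f=a\mu_1+b\mu_2+c\chi$, $h_1=\frac{1}{a-b}(a\mu_1-b\mu_2)$, $h_2=-\frac{2ab}{a-b}(\mu_1-\mu_2)$ and $h=\frac{c}{a-b}\left(-a\mu_1+b\mu_2+(a-b)\chi\right)$, where $a,b,c\in\mathbb{C}$ are constants such that $a\neq b$.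
   Context: A character of a group $G$ is a homomorphism from $G$ into the multiplicative group $\mathbb{C}^*$ of nonzero complex numbers. "Arbitrary" means an arbitrary function $G\to\mathbb{C}$. Within a given form, $\varphi_{\mu,\chi}$ denotes one and the same function at each occurrence. *)

theory Defs
  imports Complex_Main "HOL-Algebra.Group"
begin

definition nonzero_complex :: "complex monoid" where
  "nonzero_complex = \<lparr>carrier = - {0}, mult = (*), one = 1\<rparr>"

text \<open>Functions on a group are total HOL functions of which only the values on the carrier matter.
  In particular, equality of such functions always has to be read as equality on the carrier.\<close>

definition group_character :: "('a, 'b) monoid_scheme \<Rightarrow> ('a \<Rightarrow> complex) \<Rightarrow> bool" where
  "group_character G \<chi> \<longleftrightarrow> \<chi> \<in> hom G nonzero_complex"

end

theory Submission
  imports Defs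
begin

text \<open>Expanding \<open>f (x \<otimes> y \<otimes> z)\<close> in two ways and comparing coefficients as functions of \<open>x\<close>
  shows that \<open>h\<^sub>2 = 0\<close> as soon as \<open>f\<close> lies outside the span of \<open>\<mu>\<^sub>1, \<mu>\<^sub>2, \<chi>\<close>: the coefficients of
  \<open>\<mu>\<^sub>1 x\<close> and \<open>\<mu>\<^sub>2 x\<close> differ by \<open>(\<mu>\<^sub>1 y - \<mu>\<^sub>2 y) * h\<^sub>2 z\<close> only. If \<open>h\<^sub>2 = 0\<close> and \<open>f\<close> is not a multiple of
  \<open>\<chi>\<close>, the same comparison makes \<open>h\<^sub>1\<close> multiplicative and gives form (1). If \<open>h\<^sub>2 \<noteq> 0\<close>, then
  \<open>f = a\<mu>\<^sub>1 + b\<mu>\<^sub>2 + c\<chi>\<close>, and the linear independence of the characters turns the equation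
  into a linear system for \<open>h\<^sub>1, h\<^sub>2, h\<close>.\<close>

section \<open>Elementary properties of characters\<close>

lemma group_character_mult:
  assumes "group_character G p" "x \<in> carrier G" "y \<in> carrier G"
  shows "p (x \<otimes>\<^bsub>G\<^esub> y) = p x * p y"
  using assms by (auto simp: group_character_def nonzero_complex_def hom_def)

lemma group_character_nonzero:
  assumes "group_character G p" "x \<in> carrier G"
  shows "p x \<noteq> 0"
  using assms by (auto simp: group_character_def nonzero_complex_def hom_def)

lemma group_character_one:
  assumes "group G" "group_character G p"
  shows "p \<one>\<^bsub>G\<^esub> = 1"
proof -
  interpret group G by fact
  have "p \<one>\<^bsub>G\<^esub> * p \<one>\<^bsub>G\<^esub> = p \<one>\<^bsub>G\<^esub>"
    using group_character_mult[OF assms(2), of "\<one>\<^bsub>G\<^esub>" "\<one>\<^bsub>G\<^esub>"] by simp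
  then show ?thesis
    using group_character_nonzero[OF assms(2), of "\<one>\<^bsub>G\<^esub>"] by simp
qed

text \<open>The value 1 at the identity rules out zeros, because the values at \<open>x\<close> and
  at its inverse multiply to 1.\<close>

lemma group_characterI:
  assumes "group G"
    and mult: "\<And>x y. x \<in> carrier G \<Longrightarrow> y \<in> carrier G \<Longrightarrow> p (x \<otimes>\<^bsub>G\<^esub> y) = p x * p y"
    and one: "p \<one>\<^bsub>G\<^esub> = 1"
  shows "group_character G p"
proof -
  interpret group G by fact
  have "p x \<noteq> 0" if "x \<in> carrier G" for x
    using mult[of x "inv\<^bsub>G\<^esub> x"] one that by auto
  then show ?thesis
    using mult by (auto simp: group_character_def nonzero_complex_def hom_def)
qed

section \<open>Linear independence of characters\<close>

text \<open>Combining the relation at the points \<open>y \<otimes> z\<close>, \<open>z\<close>,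
  \<open>y\<close> and \<open>\<one>\<close> with weights 1, \<open>- r y\<close>,
  \<open>- q z\<close> and \<open>q z * r y\<close> cancels the terms of \<open>q\<close> and
  \<open>r\<close> and leaves \<alpha> times \<open>(p y - r y) * (p z - q z)\<close>.\<close>

lemma character_combination_coeff_zero:
  assumes "group G"
    and p: "group_character G p" and q: "group_character G q" and r: "group_character G r"
    and "\<exists>x\<in>carrier G. p x \<noteq> q x" and "\<exists>x\<in>carrier G. p x \<noteq> r x"
    and E: "\<And>x. x \<in> carrier G \<Longrightarrow> \<alpha> * p x + \<beta> * q x + \<gamma> * r x = 0"
  shows "\<alpha> = 0"
proof -
  interpret group G by fact
  \<comment> \<open>The point \<open>y\<close> will eliminate \<open>r\<close> and the point
    \<open>z\<close> will eliminate \<open>q\<close>.\<close>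
  obtain y z where y: "y \<in> carrier G" "p y \<noteq> r y" and z: "z \<in> carrier G" "p z \<noteq> q z"
    using assms by auto
  have E1: "\<alpha> + \<beta> + \<gamma> = 0"
    using E[OF one_closed] by (simp add: group_character_one[OF \<open>group G\<close>] p q r)
  have Ey: "\<alpha> * p y + \<beta> * q y + \<gamma> * r y = 0" and Ez: "\<alpha> * p z + \<beta> * q z + \<gamma> * r z = 0"
    using E y z by auto
  have Eyz: "\<alpha> * (p y * p z) + \<beta> * (q y * q z) + \<gamma> * (r y * r z) = 0"
    using E[OF m_closed[OF y(1) z(1)]] group_character_mult y z p q r by metis
  have "\<alpha> * (p y - r y) * (p z - q z) =
      (\<alpha> * (p y * p z) + \<beta> * (q y * q z) + \<gamma> * (r y * r z))
      - r y * (\<alpha> * p z + \<beta> * q z + \<gamma> * r z)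
      - q z * (\<alpha> * p y + \<beta> * q y + \<gamma> * r y) + q z * r y * (\<alpha> + \<beta> + \<gamma>)"
    by (simp add: algebra_simps)
  then have "\<alpha> * (p y - r y) * (p z - q z) = 0"
    by (simp only: E1 Ey Ez Eyz) simp
  then show ?thesis
    using y z by simp
qed

lemma characters_linearly_independent:
  assumes "group G"
    and "group_character G p" and "group_character G q" and "group_character G r"
    and "\<exists>x\<in>carrier G. p x \<noteq> q x" and "\<exists>x\<in>carrier G. p x \<noteq> r x"
    and "\<exists>x\<in>carrier G. q x \<noteq> r x"
    and E: "\<And>x. x \<in> carrier G \<Longrightarrow> \<alpha> * p x + \<beta> * q x + \<gamma> * r x = 0"
  shows "\<alpha> = 0" "\<beta> = 0" "\<gamma> = 0"
proof -
  have qp: "\<exists>x\<in>carrier G. q x \<noteq> p x" and rp: "\<exists>x\<in>carrier G. r x \<noteq> p x"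
    and rq: "\<exists>x\<in>carrier G. r x \<noteq> q x"
    using assms(5-7) by metis+
  show "\<alpha> = 0"
    by (rule character_combination_coeff_zero[OF assms(1-6) E])
  have "\<beta> * q x + \<alpha> * p x + \<gamma> * r x = 0" if "x \<in> carrier G" for x
    using E[OF that] by (simp add: algebra_simps)
  from character_combination_coeff_zero[OF assms(1,3,2,4) qp assms(7) this]
  show "\<beta> = 0" .
  have "\<gamma> * r x + \<alpha> * p x + \<beta> * q x = 0" if "x \<in> carrier G" for x
    using E[OF that] by (simp add: algebra_simps)
  from character_combination_coeff_zero[OF assms(1,4,2,3) rp rq this]
  show "\<gamma> = 0" .
qed

section \<open>The equation without the term in \<open>g\<close>\<close>

text \<open>As \<chi> does not vanish, \<open>indep\<close> makes \<open>f\<close> and \<chi>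
  linearly independent, so their coefficients in the expanded associativity law can be compared. The
  conclusions are the ingredients of form (1), with \<open>k\<close> as \<mu>, \<open>h\<close> as
  \<phi> and \<open>f \<one>\<close> as the constant.\<close>

lemma sine_type_equation_solution:
  fixes G :: "('a, 'b) monoid_scheme" (structure)
    and f k h \<chi> :: "'a \<Rightarrow> complex"
  assumes "group G" and \<chi>: "group_character G \<chi>"
    and eq: "\<And>x y. x \<in> carrier G \<Longrightarrow> y \<in> carrier G \<Longrightarrow> f (x \<otimes> y) = f x * k y + \<chi> x * h y"
    and indep: "\<nexists>c. \<forall>x\<in>carrier G. f x = c * \<chi> x"
  shows "group_character G k"
    and "\<And>x y. x \<in> carrier G \<Longrightarrow> y \<in> carrier G \<Longrightarrow> h (x \<otimes> y) = h x * k y + \<chi> x * h y"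
    and "\<And>x. x \<in> carrier G \<Longrightarrow> f x = f \<one> * k x + h x"
proof -
  interpret group G by fact
  have zero: "A = 0 \<and> B = 0" if *: "\<And>x. x \<in> carrier G \<Longrightarrow> A * f x + B * \<chi> x = 0" for A B
  proof -
    have "A = 0"
    proof (rule ccontr)
      assume "A \<noteq> 0"
      then have "\<forall>x\<in>carrier G. f x = (- B / A) * \<chi> x"
        using * by (auto simp: field_simps eq_neg_iff_add_eq_0)
      then show False
        using indep by blast
    qed
    then show ?thesis
      using *[OF one_closed] group_character_one[OF \<open>group G\<close> \<chi>] by simp
  qed
  have coeffs: "k (y \<otimes> z) - k y * k z = 0 \<and> h (y \<otimes> z) - (h y * k z + \<chi> y * h z) = 0"
    if y: "y \<in> carrier G" and z: "z \<in> carrier G" for y z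
  proof (rule zero)
    fix x assume x: "x \<in> carrier G"
    have "f x * k (y \<otimes> z) + \<chi> x * h (y \<otimes> z) = f (x \<otimes> y) * k z + \<chi> (x \<otimes> y) * h z"
      using eq[of x "y \<otimes> z"] eq[of "x \<otimes> y" z] x y z by (simp add: m_assoc)
    also have "\<dots> = (f x * k y + \<chi> x * h y) * k z + \<chi> x * \<chi> y * h z"
      using eq group_character_mult[OF \<chi>] x y by simp
    finally show "(k (y \<otimes> z) - k y * k z) * f x + (h (y \<otimes> z) - (h y * k z + \<chi> y * h z)) * \<chi> x = 0"
      by (simp add: algebra_simps)
  qed
  \<comment> \<open>Putting \<open>y = \<one>\<close> in the equation relates \<open>f\<close> and
    \<chi> linearly; the value of \<open>k\<close> found there excludes the zero function.\<close>
  have "k \<one> - 1 = 0 \<and> h \<one> = 0"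
    by (rule zero) (use eq[of _ \<one>] in \<open>auto simp: algebra_simps\<close>)
  then show "group_character G k"
    using coeffs by (intro group_characterI[OF \<open>group G\<close>]) auto
  show "h (x \<otimes> y) = h x * k y + \<chi> x * h y" if "x \<in> carrier G" "y \<in> carrier G" for x y
    using coeffs that by simp
  show "f x = f \<one> * k x + h x" if "x \<in> carrier G" for x
    using eq[of \<one> x] that group_character_one[OF \<open>group G\<close> \<chi>] by simp
qed

section \<open>The case of nonzero \<open>h\<^sub>2\<close>\<close>

text \<open>Translation by a \<open>y\<close> that separates \<open>\<mu>\<^sub>1\<close> from
  \<open>\<mu>\<^sub>2\<close> scales the two halves of \<open>g\<close> by different factors. With
  \<open>h\<^sub>2 z\<close> nonzero, associativity therefore yields a nontrivial linear relation
  between \<open>f\<close> and the three characters, and by their independence \<open>f\<close>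
  occurs in it.\<close>

lemma in_span_of_characters:
  fixes G :: "('a, 'b) monoid_scheme" (structure)
    and \<mu>\<^sub>1 \<mu>\<^sub>2 \<chi> f h\<^sub>1 h\<^sub>2 h :: "'a \<Rightarrow> complex"
  assumes "group G"
    and \<mu>\<^sub>1: "group_character G \<mu>\<^sub>1" and \<mu>\<^sub>2: "group_character G \<mu>\<^sub>2" and \<chi>: "group_character G \<chi>"
    and ne: "\<exists>x\<in>carrier G. \<mu>\<^sub>1 x \<noteq> \<mu>\<^sub>2 x" "\<exists>x\<in>carrier G. \<mu>\<^sub>1 x \<noteq> \<chi> x" "\<exists>x\<in>carrier G. \<mu>\<^sub>2 x \<noteq> \<chi> x"
    and eq: "\<And>x y. x \<in> carrier G \<Longrightarrow> y \<in> carrier G \<Longrightarrow>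
      f (x \<otimes> y) = f x * h\<^sub>1 y + (\<mu>\<^sub>1 x + \<mu>\<^sub>2 x) / 2 * h\<^sub>2 y + \<chi> x * h y"
    and h\<^sub>2: "\<exists>x\<in>carrier G. h\<^sub>2 x \<noteq> 0"
  shows "\<exists>a b c. \<forall>x\<in>carrier G. f x = a * \<mu>\<^sub>1 x + b * \<mu>\<^sub>2 x + c * \<chi> x"
proof (rule ccontr)
  assume span: "\<nexists>a b c. \<forall>x\<in>carrier G. f x = a * \<mu>\<^sub>1 x + b * \<mu>\<^sub>2 x + c * \<chi> x"
  interpret group G by fact
  obtain y z where y: "y \<in> carrier G" "\<mu>\<^sub>1 y \<noteq> \<mu>\<^sub>2 y" and z: "z \<in> carrier G" "h\<^sub>2 z \<noteq> 0"
    using ne h\<^sub>2 by auto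
  \<comment> \<open>For fixed \<open>y\<close> and \<open>z\<close>, these are the coefficients of
    \<open>f x\<close>, \<open>\<mu>\<^sub>1 x\<close>, \<open>\<mu>\<^sub>2 x\<close> and
    \<open>\<chi> x\<close> in the difference of the two expansions of
    \<open>f (x \<otimes> y \<otimes> z)\<close>.\<close>
  define A where "A = h\<^sub>1 (y \<otimes> z) - h\<^sub>1 y * h\<^sub>1 z"
  define B\<^sub>1 where "B\<^sub>1 = (h\<^sub>2 (y \<otimes> z) - h\<^sub>2 y * h\<^sub>1 z - \<mu>\<^sub>1 y * h\<^sub>2 z) / 2"
  define B\<^sub>2 where "B\<^sub>2 = (h\<^sub>2 (y \<otimes> z) - h\<^sub>2 y * h\<^sub>1 z - \<mu>\<^sub>2 y * h\<^sub>2 z) / 2"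
  define C where "C = h (y \<otimes> z) - h y * h\<^sub>1 z - \<chi> y * h z"
  have comb: "A * f x + B\<^sub>1 * \<mu>\<^sub>1 x + B\<^sub>2 * \<mu>\<^sub>2 x + C * \<chi> x = 0" if x: "x \<in> carrier G" for x
  proof -
    have "f x * h\<^sub>1 (y \<otimes> z) + (\<mu>\<^sub>1 x + \<mu>\<^sub>2 x) / 2 * h\<^sub>2 (y \<otimes> z) + \<chi> x * h (y \<otimes> z)
      = f (x \<otimes> y) * h\<^sub>1 z + (\<mu>\<^sub>1 (x \<otimes> y) + \<mu>\<^sub>2 (x \<otimes> y)) / 2 * h\<^sub>2 z + \<chi> (x \<otimes> y) * h z"
      using eq[of x "y \<otimes> z"] eq[of "x \<otimes> y" z] x y z by (simp add: m_assoc)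
    also have "\<dots> = (f x * h\<^sub>1 y + (\<mu>\<^sub>1 x + \<mu>\<^sub>2 x) / 2 * h\<^sub>2 y + \<chi> x * h y) * h\<^sub>1 z
        + (\<mu>\<^sub>1 x * \<mu>\<^sub>1 y + \<mu>\<^sub>2 x * \<mu>\<^sub>2 y) / 2 * h\<^sub>2 z + \<chi> x * \<chi> y * h z"
      using eq \<mu>\<^sub>1 \<mu>\<^sub>2 \<chi> x y by (simp add: group_character_mult)
    finally show ?thesis
      unfolding A_def B\<^sub>1_def B\<^sub>2_def C_def
      by (simp add: algebra_simps add_divide_distrib diff_divide_distrib)
  qed
  have "A = 0"
  proof (rule ccontr)
    assume A: "A \<noteq> 0"
    have "f x = (- B\<^sub>1 / A) * \<mu>\<^sub>1 x + (- B\<^sub>2 / A) * \<mu>\<^sub>2 x + (- C / A) * \<chi> x" if "x \<in> carrier G" for x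
    proof -
      have "A * f x = - B\<^sub>1 * \<mu>\<^sub>1 x - B\<^sub>2 * \<mu>\<^sub>2 x - C * \<chi> x"
        using comb[OF that] by (simp add: algebra_simps eq_neg_iff_add_eq_0)
      then have "f x = (- B\<^sub>1 * \<mu>\<^sub>1 x - B\<^sub>2 * \<mu>\<^sub>2 x - C * \<chi> x) / A"
        using A by (simp add: nonzero_eq_divide_eq mult.commute)
      then show ?thesis
        by (simp add: diff_divide_distrib)
    qed
    then show False
      using span by blast
  qed
  then have "B\<^sub>1 * \<mu>\<^sub>1 x + B\<^sub>2 * \<mu>\<^sub>2 x + C * \<chi> x = 0" if "x \<in> carrier G" for x
    using comb[OF that] by simp
  then have "B\<^sub>1 = 0" "B\<^sub>2 = 0"
    using characters_linearly_independent[OF assms(1-7)] by blast+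
  \<comment> \<open>This is twice \<open>B\<^sub>2 - B\<^sub>1\<close>.\<close>
  then have "(\<mu>\<^sub>1 y - \<mu>\<^sub>2 y) * h\<^sub>2 z = 0"
    unfolding B\<^sub>1_def B\<^sub>2_def by (simp add: algebra_simps)
  then show False
    using y z by simp
qed

section \<open>Classification of the solutions\<close>

theorem theorem4p2:
  fixes G :: "('a, 'b) monoid_scheme" (structure)
    and \<mu>\<^sub>1 \<mu>\<^sub>2 \<chi> g f h\<^sub>1 h\<^sub>2 h :: "'a \<Rightarrow> complex"
  assumes "group G"
    and "group_character G \<mu>\<^sub>1" and "group_character G \<mu>\<^sub>2" and "group_character G \<chi>"
    and "\<exists>x\<in>carrier G. \<mu>\<^sub>1 x \<noteq> \<mu>\<^sub>2 x"
    and "\<exists>x\<in>carrier G. \<mu>\<^sub>1 x \<noteq> \<chi> x"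
    and "\<exists>x\<in>carrier G. \<mu>\<^sub>2 x \<noteq> \<chi> x"
    and "\<forall>x\<in>carrier G. g x = (\<mu>\<^sub>1 x + \<mu>\<^sub>2 x) / 2"
  shows "(\<forall>x\<in>carrier G. \<forall>y\<in>carrier G. f (x \<otimes> y) = f x * h\<^sub>1 y + g x * h\<^sub>2 y + \<chi> x * h y)
    \<longleftrightarrow>
      (\<exists>\<mu> c \<phi>. group_character G \<mu> \<and>
         (\<forall>x\<in>carrier G. \<forall>y\<in>carrier G. \<phi> (x \<otimes> y) = \<phi> x * \<mu> y + \<chi> x * \<phi> y) \<and>
         (\<forall>x\<in>carrier G. f x = c * \<mu> x + \<phi> x \<and> h\<^sub>1 x = \<mu> x \<and> h\<^sub>2 x = 0 \<and> h x = \<phi> x))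
    \<or> (\<exists>c. \<forall>x\<in>carrier G. f x = c * \<chi> x \<and> h\<^sub>2 x = 0 \<and> h x = c * (\<chi> x - h\<^sub>1 x))
    \<or> (\<exists>a b c. a \<noteq> b \<and>
         (\<forall>x\<in>carrier G.
            f x = a * \<mu>\<^sub>1 x + b * \<mu>\<^sub>2 x + c * \<chi> x \<and>
            h\<^sub>1 x = 1 / (a - b) * (a * \<mu>\<^sub>1 x - b * \<mu>\<^sub>2 x) \<and>
            h\<^sub>2 x = - (2 * a * b / (a - b)) * (\<mu>\<^sub>1 x - \<mu>\<^sub>2 x) \<and>
            h x = c / (a - b) * (- a * \<mu>\<^sub>1 x + b * \<mu>\<^sub>2 x + (a - b) * \<chi> x)))"
  (is "?eq \<longleftrightarrow> ?form1 \<or> ?form2 \<or> ?form3")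
proof -
  interpret group G by fact
  note \<mu>\<^sub>1 = assms(2) and \<mu>\<^sub>2 = assms(3) and \<chi> = assms(4)
  have g: "g x = (\<mu>\<^sub>1 x + \<mu>\<^sub>2 x) / 2" if "x \<in> carrier G" for x
    using assms(8) that by blast
  show ?thesis
  proof
    assume ?eq
    then have eq: "f (x \<otimes> y) = f x * h\<^sub>1 y + (\<mu>\<^sub>1 x + \<mu>\<^sub>2 x) / 2 * h\<^sub>2 y + \<chi> x * h y"
      if "x \<in> carrier G" "y \<in> carrier G" for x y
      using that g by simp
    show "?form1 \<or> ?form2 \<or> ?form3"
    proof (cases "\<exists>x\<in>carrier G. h\<^sub>2 x \<noteq> 0")
      case False
      then have eq': "f (x \<otimes> y) = f x * h\<^sub>1 y + \<chi> x * h y"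
        if "x \<in> carrier G" "y \<in> carrier G" for x y
        using eq that by simp
      show ?thesis
      proof (cases "\<exists>c. \<forall>x\<in>carrier G. f x = c * \<chi> x")
        case True
        then obtain c where c: "\<And>x. x \<in> carrier G \<Longrightarrow> f x = c * \<chi> x"
          by blast
        \<comment> \<open>With the first argument equal to \<open>\<one>\<close>, the equation reads
          \<open>c * \<chi> x = c * h\<^sub>1 x + h x\<close>; it determines \<open>h\<close> and
          leaves \<open>h\<^sub>1\<close> free.\<close>
        have "h x = c * (\<chi> x - h\<^sub>1 x)" if "x \<in> carrier G" for x
          using eq'[OF one_closed that] c that group_character_one[OF \<open>group G\<close> \<chi>]
          by (simp add: algebra_simps)
        then have ?form2
          using False c by blast
        then show ?thesis
          by blast
      next
        case indep: False
        note sol = sine_type_equation_solution[OF \<open>group G\<close> \<chi> eq' indep]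
        have ?form1
        proof (rule exI[of _ h\<^sub>1], rule exI[of _ "f \<one>"], rule exI[of _ h], intro conjI ballI)
          show "group_character G h\<^sub>1"
            by (rule sol(1))
        qed (use sol(2,3) False in blast)+
        then show ?thesis
          by blast
      qed
    next
      case True
      then obtain a b c where f: "\<And>x. x \<in> carrier G \<Longrightarrow> f x = a * \<mu>\<^sub>1 x + b * \<mu>\<^sub>2 x + c * \<chi> x"
        using in_span_of_characters[OF assms(1-7) eq] by blast
      \<comment> \<open>Insert the expression for \<open>f\<close> on both sides, fix
        \<open>y\<close>, and compare the coefficients of the independent characters as functions of
        \<open>x\<close>.\<close>
      have sys: "a * \<mu>\<^sub>1 y = a * h\<^sub>1 y + h\<^sub>2 y / 2 \<and> b * \<mu>\<^sub>2 y = b * h\<^sub>1 y + h\<^sub>2 y / 2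
          \<and> h y = c * (\<chi> y - h\<^sub>1 y)"
        if y: "y \<in> carrier G" for y
      proof -
        have "(a * \<mu>\<^sub>1 y - a * h\<^sub>1 y - h\<^sub>2 y / 2) * \<mu>\<^sub>1 x + (b * \<mu>\<^sub>2 y - b * h\<^sub>1 y - h\<^sub>2 y / 2) * \<mu>\<^sub>2 x
          + (c * \<chi> y - c * h\<^sub>1 y - h y) * \<chi> x = 0" if x: "x \<in> carrier G" for x
          using eq[OF x y] x y \<mu>\<^sub>1 \<mu>\<^sub>2 \<chi>
          by (simp add: f group_character_mult algebra_simps add_divide_distrib)
        note zero = characters_linearly_independent[OF assms(1-7) this]
        from zero show ?thesis
          by (simp add: algebra_simps)
      qed
      \<comment> \<open>For equal \<open>a\<close> and \<open>b\<close>, the first two equations of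
        \<open>sys\<close> give \<open>b * \<mu>\<^sub>1 y = b * \<mu>\<^sub>2 y\<close>. A
        separating \<open>y\<close> forces \<open>b = 0\<close>, and then \<open>h\<^sub>2\<close>
        vanishes identically, against the case assumption.\<close>
      have "a \<noteq> b"
      proof
        assume [simp]: "a = b"
        obtain y where y: "y \<in> carrier G" "\<mu>\<^sub>1 y \<noteq> \<mu>\<^sub>2 y"
          using assms(5) by blast
        then have "b * \<mu>\<^sub>1 y = b * \<mu>\<^sub>2 y"
          using sys by simp
        with y have "b = 0"
          by simp
        then show False
          using sys True by auto
      qed
      have "h\<^sub>1 x = 1 / (a - b) * (a * \<mu>\<^sub>1 x - b * \<mu>\<^sub>2 x) \<and>
            h\<^sub>2 x = - (2 * a * b / (a - b)) * (\<mu>\<^sub>1 x - \<mu>\<^sub>2 x) \<and>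
            h x = c / (a - b) * (- a * \<mu>\<^sub>1 x + b * \<mu>\<^sub>2 x + (a - b) * \<chi> x)"
        if "x \<in> carrier G" for x
      proof -
        have div: "u = v / (a - b)" if "(a - b) * u = v" for u v
          using that \<open>a \<noteq> b\<close> by auto
        have s: "a * \<mu>\<^sub>1 x = a * h\<^sub>1 x + h\<^sub>2 x / 2" "b * \<mu>\<^sub>2 x = b * h\<^sub>1 x + h\<^sub>2 x / 2"
          "h x = c * (\<chi> x - h\<^sub>1 x)"
          using sys[OF that] by auto
        \<comment> \<open>Subtracting the first two equations eliminates \<open>h\<^sub>2 x\<close>;
          substitution then gives the other two functions. The factor \<open>a - b\<close> stays on
          the left until \<open>div\<close> removes it.\<close>
        have 1: "(a - b) * h\<^sub>1 x = a * \<mu>\<^sub>1 x - b * \<mu>\<^sub>2 x"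
          using s by (simp add: algebra_simps)
        have h\<^sub>2: "h\<^sub>2 x = 2 * (a * \<mu>\<^sub>1 x - a * h\<^sub>1 x)"
          using s by simp
        have 2: "(a - b) * h\<^sub>2 x = - (2 * a * b) * (\<mu>\<^sub>1 x - \<mu>\<^sub>2 x)"
        proof -
          have "(a - b) * h\<^sub>2 x = 2 * a * ((a - b) * \<mu>\<^sub>1 x) - 2 * a * ((a - b) * h\<^sub>1 x)"
            unfolding h\<^sub>2 by (simp add: algebra_simps)
          then show ?thesis
            unfolding 1 by (simp add: algebra_simps)
        qed
        have 3: "(a - b) * h x = c * (- a * \<mu>\<^sub>1 x + b * \<mu>\<^sub>2 x + (a - b) * \<chi> x)"
        proof -
          have "(a - b) * h x = c * ((a - b) * \<chi> x - (a - b) * h\<^sub>1 x)"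
            unfolding s(3) by (simp add: algebra_simps)
          then show ?thesis
            unfolding 1 by (simp add: algebra_simps)
        qed
        show ?thesis
          using div[OF 1] div[OF 2] div[OF 3] by simp
      qed
      then have ?form3
        using \<open>a \<noteq> b\<close> f by blast
      then show ?thesis
        by blast
    qed
  next
    assume "?form1 \<or> ?form2 \<or> ?form3"
    then show ?eq
    proof (elim disjE)
      assume ?form1
      then show ?eq
        by (auto simp: group_character_mult algebra_simps)
    next
      assume ?form2
      then obtain c where "\<And>x. x \<in> carrier G \<Longrightarrow> f x = c * \<chi> x \<and> h\<^sub>2 x = 0 \<and> h x = c * (\<chi> x - h\<^sub>1 x)"
        by blast
      then show ?eq
        using \<chi> by (simp add: group_character_mult right_diff_distrib)
    next
      assume ?form3
      then obtain a b c where "a \<noteq> b" and sol: "\<forall>x\<in>carrier G.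
            f x = a * \<mu>\<^sub>1 x + b * \<mu>\<^sub>2 x + c * \<chi> x \<and>
            h\<^sub>1 x = 1 / (a - b) * (a * \<mu>\<^sub>1 x - b * \<mu>\<^sub>2 x) \<and>
            h\<^sub>2 x = - (2 * a * b / (a - b)) * (\<mu>\<^sub>1 x - \<mu>\<^sub>2 x) \<and>
            h x = c / (a - b) * (- a * \<mu>\<^sub>1 x + b * \<mu>\<^sub>2 x + (a - b) * \<chi> x)"
        by blast
      show ?eq
      proof (intro ballI)
        fix x y assume x: "x \<in> carrier G" and y: "y \<in> carrier G"
        \<comment> \<open>Treating the reciprocal as an unknown \<open>d\<close> turns the
          verification into a polynomial identity, with \<open>d * (a - b) = 1\<close> applied only
          at the end.\<close>
        define d where "d = 1 / (a - b)"
        have d: "d * (a - b) = 1"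
          using \<open>a \<noteq> b\<close> by (simp add: d_def)
        have fx: "f x = a * \<mu>\<^sub>1 x + b * \<mu>\<^sub>2 x + c * \<chi> x"
          and fxy: "f (x \<otimes> y) = a * (\<mu>\<^sub>1 x * \<mu>\<^sub>1 y) + b * (\<mu>\<^sub>2 x * \<mu>\<^sub>2 y) + c * (\<chi> x * \<chi> y)"
          using sol x y \<mu>\<^sub>1 \<mu>\<^sub>2 \<chi> by (simp_all add: group_character_mult)
        have hy: "h\<^sub>1 y = d * (a * \<mu>\<^sub>1 y - b * \<mu>\<^sub>2 y)"
          "h\<^sub>2 y = - (2 * a * b * d) * (\<mu>\<^sub>1 y - \<mu>\<^sub>2 y)"
          "h y = c * d * (- a * \<mu>\<^sub>1 y + b * \<mu>\<^sub>2 y + (a - b) * \<chi> y)"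
          using bspec[OF sol y] by (simp_all add: d_def)
        \<comment> \<open>The mixed products of \<open>\<mu>\<^sub>1\<close> and
          \<open>\<mu>\<^sub>2\<close> cancel between the first two summands, and those of
          \<open>\<chi> x\<close> with \<open>\<mu>\<^sub>1 y\<close> or
          \<open>\<mu>\<^sub>2 y\<close> between the first and the third.\<close>
        have "f x * h\<^sub>1 y + g x * h\<^sub>2 y + \<chi> x * h y
            = (d * (a - b)) * (a * (\<mu>\<^sub>1 x * \<mu>\<^sub>1 y) + b * (\<mu>\<^sub>2 x * \<mu>\<^sub>2 y) + c * (\<chi> x * \<chi> y))"
          unfolding fx hy g[OF x] by (simp add: algebra_simps add_divide_distrib)
        then show "f (x \<otimes> y) = f x * h\<^sub>1 y + g x * h\<^sub>2 y + \<chi> x * h y"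
          unfolding fxy d by simp
      qed
    qed
  qed
qed

end
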